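(* Let $A \in \mathbb{R}^{m \times n}$, let $P$ be a unit domain, and let $r$ be a nonnegative integer. Then there is a matrix $\widehat{A}$ that is a linear combination of $r$ rank one matrices of the form $v w^T$ with $(v,w) \in P$, satisfying $$\|A - \widehat{A}\|_P \le \frac{\|\varsigma^{(r+1)}\|_2}{\sqrt{r+1}} \le \frac{\|A\|_F}{\sqrt{r+1}},$$ where $\varsigma^{(r+1)} = (\sigma_1, \dots, \sigma_{r+1})$ are the first $r+1$ projection values of $A$ with respect to $P$.
   Context: A unit domain is a set $P \subseteq \{(v,w) \in \mathbb{R}^m \times \mathbb{R}^n : \|v\|_2 = \|w\|_2 = 1\}$. The $P$-norm of $X \in \mathbb{R}^{m\times n}$ is $\|X\|_P = \max_{(v,w)\in P} |v^T X w|$. Matrices carry the Frobenius inner product $\langle X, Y\rangle_F = \mathrm{Tr}(XY^T)$ with norm $\|\cdot\|_F$. For $Q \subseteq P$, $\mathrm{Proj}_Q(X)$ is the orthogonal projection (in Frobenius inner product) of $X$ onto $\mathrm{span}\{v w^T : (v,w) \in Q\}$. Greedy ordering of $P$ with respect to $A$: $P^{(0)} = \emptyset$; given $P^{(j)}$, the next element is a pair $p_{j+1} = (v,w)\in P$ maximizing $|v^T(A - \mathrm{Proj}_{P^{(j)}}(A))w|$ (ties broken arbitrarily; $P$ is assumed such that these maxima are attained), and $P^{(j+1)} = P^{(j)}\cup\{p_{j+1}\}$. The projection values are $\sigma_j = \|\mathrm{Proj}_{P^{(j)}}(A) - \mathrm{Proj}_{P^{(j-1)}}(A)\|_F$ for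 $j \ge 1$. *)

theory Defs
  imports "HOL-Analysis.Analysis"
begin

definition unit_domain :: "((real^'m) \<times> (real^'n)) set \<Rightarrow> bool" where
  "unit_domain P \<longleftrightarrow> (\<forall>(v, w)\<in>P. norm v = 1 \<and> norm w = 1)"

definition rank_one :: "(real^'m) \<times> (real^'n) \<Rightarrow> real^'n^'m" where
  "rank_one = (\<lambda>(v, w). \<chi> i j. v $ i * w $ j)"

definition abs_form :: "real^'n^'m \<Rightarrow> (real^'m) \<times> (real^'n) \<Rightarrow> real" where
  "abs_form X = (\<lambda>(v, w). \<bar>v \<bullet> (X *v w)\<bar>)"

(* Written with a supremum so that it makes sense for every nonempty unit domain;
   it is the maximum whenever that is attained (P_norm_eq_max below). *)
definition P_norm :: "((real^'m) \<times> (real^'n)) set \<Rightarrow> real^'n^'m \<Rightarrow> real" where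
  "P_norm P X = (SUP p\<in>P. abs_form X p)"

(* The inner product and the norm of the type real^'n^'m are the Frobenius ones,
   see inner_eq_trace below. *)
definition Proj :: "((real^'m) \<times> (real^'n)) set \<Rightarrow> real^'n^'m \<Rightarrow> real^'n^'m" where
  "Proj Q X = (THE Y. Y \<in> span (rank_one ` Q) \<and> (\<forall>Z\<in>span (rank_one ` Q). (X - Y) \<bullet> Z = 0))"

(* p 1, p 2, ... are the successively chosen pairs and p ` {1..j} is the set of the first j
   of them; p 0 plays no role.  Ties may be broken arbitrarily, and a pair may be chosen
   again once the maximum is 0. *)
definition greedy_ordering ::
  "((real^'m) \<times> (real^'n)) set \<Rightarrow> real^'n^'m \<Rightarrow> (nat \<Rightarrow> (real^'m) \<times> (real^'n)) \<Rightarrow> bool" where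
  "greedy_ordering P A p \<longleftrightarrow>
     (\<forall>j. is_arg_max (abs_form (A - Proj (p ` {1..j}) A)) (\<lambda>q. q \<in> P) (p (Suc j)))"

(* Meant for j \<ge> 1 *)
definition proj_value ::
  "real^'n^'m \<Rightarrow> (nat \<Rightarrow> (real^'m) \<times> (real^'n)) \<Rightarrow> nat \<Rightarrow> real" where
  "proj_value A p j = norm (Proj (p ` {1..j}) A - Proj (p ` {1..j - 1}) A)"

lemma inner_eq_trace: "X \<bullet> Y = trace (X ** transpose Y)" for X Y :: "real^'n^'m"
  by (simp add: trace_def matrix_matrix_mult_def transpose_def inner_vec_def)

lemma P_norm_eq_max:
  assumes "is_arg_max (abs_form X) (\<lambda>q. q \<in> P) p"
  shows "P_norm P X = abs_form X p"
  unfolding P_norm_def using assms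
  by (intro cSup_eq_maximum) (auto simp: is_arg_max_linorder)

lemma Proj_unique_existence:
  "\<exists>!Y. Y \<in> span (rank_one ` Q) \<and> (\<forall>Z\<in>span (rank_one ` Q). (X - Y) \<bullet> Z = 0)"
proof -
  obtain y z where yz: "y \<in> span (rank_one ` Q)"
      "\<And>w. w \<in> span (rank_one ` Q) \<Longrightarrow> orthogonal z w" "X = y + z"
    using orthogonal_subspace_decomp_exists[of "rank_one ` Q" X] by blast
  show ?thesis
  proof (rule ex1I[of _ y])
    show "y \<in> span (rank_one ` Q) \<and> (\<forall>Z\<in>span (rank_one ` Q). (X - y) \<bullet> Z = 0)"
      using yz by (auto simp: orthogonal_def)
  next
    fix Y assume Y: "Y \<in> span (rank_one ` Q) \<and> (\<forall>Z\<in>span (rank_one ` Q). (X - Y) \<bullet> Z = 0)"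
    have s: "y - Y \<in> span (rank_one ` Q)" using Y yz by (simp add: span_diff)
    have "(X - Y) \<bullet> (y - Y) = 0" "z \<bullet> (y - Y) = 0"
      using Y yz s by (auto simp: orthogonal_def)
    then have "(y - Y) \<bullet> (y - Y) = 0"
      using yz(3) by (simp add: inner_diff_left inner_add_left)
    then show "Y = y" by simp
  qed
qed

lemma greedy_ordering_exists:
  assumes "\<And>X. \<exists>q. is_arg_max (abs_form X) (\<lambda>q. q \<in> P) q"
  shows "\<exists>p. greedy_ordering P A p"
proof -
  define pick where "pick Q = (SOME q. is_arg_max (abs_form (A - Proj Q A)) (\<lambda>q. q \<in> P) q)" for Q
  define S where "S = rec_nat {} (\<lambda>_ Q. insert (pick Q) Q)"
  define p where "p j = pick (S (j - 1))" for j
  have pick: "is_arg_max (abs_form (A - Proj Q A)) (\<lambda>q. q \<in> P) (pick Q)" for Q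
    unfolding pick_def by (rule someI_ex) (rule assms)
  have "p ` {1..j} = S j" for j
    by (induction j) (simp_all add: S_def p_def atLeastAtMostSuc_conv)
  then have "greedy_ordering P A p"
    unfolding greedy_ordering_def using pick by (simp add: p_def)
  then show ?thesis by blast
qed

end

theory Submission
  imports Defs
begin

text \<open>
  Write \<open>A\<^sub>j\<close> for the projection after \<open>j\<close> greedy steps and \<open>u\<close> for the rank one matrix of the
  next pair. As \<open>A - A\<^sub>j\<^sub>+\<^sub>1\<close> is orthogonal to the unit vector \<open>u\<close>, the \<open>P\<close>-norm of \<open>A - A\<^sub>j\<close> is
  \<open>\<bar>(A - A\<^sub>j) \<bullet> u\<bar> = \<bar>(A\<^sub>j\<^sub>+\<^sub>1 - A\<^sub>j) \<bullet> u\<bar> \<le> \<sigma>\<^sub>j\<^sub>+\<^sub>1\<close>. Among \<open>j = 0, \<dots>, r\<close> take the one with least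
  \<open>\<sigma>\<^sub>j\<^sub>+\<^sub>1\<close>; the minimum is at most the root mean square. By Pythagoras the \<open>\<sigma>\<^sub>j\<^sup>2\<close> sum up to
  the squared norm of \<open>A\<^sub>r\<^sub>+\<^sub>1\<close>, which is at most that of \<open>A\<close>.
\<close>

text \<open>Expanding both sides gives the same double sum. This turns the greedy objective into a
  Frobenius inner product, to which the orthogonality of \<open>Proj\<close> applies.\<close>

lemma abs_form_eq_inner: "abs_form X q = \<bar>X \<bullet> rank_one q\<bar>"
  by (simp add: abs_form_def rank_one_def inner_vec_def matrix_vector_mult_def
      sum_distrib_left algebra_simps split: prod.split)

lemma norm_rank_one: "norm (rank_one q) = norm (fst q) * norm (snd q)"
proof -
  obtain v w where q: "q = (v, w)" by fastforce
  have "rank_one q \<bullet> rank_one q = (v \<bullet> v) * (w \<bullet> w)"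
    by (simp add: q rank_one_def inner_vec_def sum_product) (simp add: mult_ac)
  then show ?thesis
    by (simp add: q norm_eq_sqrt_inner real_sqrt_mult)
qed

lemma norm_rank_one_unit_domain:
  assumes "unit_domain P" "q \<in> P"
  shows "norm (rank_one q) = 1"
  using assms by (auto simp: norm_rank_one unit_domain_def)

lemma Proj_in_span: "Proj Q X \<in> span (rank_one ` Q)"
  and Proj_orthogonal: "Z \<in> span (rank_one ` Q) \<Longrightarrow> (X - Proj Q X) \<bullet> Z = 0"
  using theI'[OF Proj_unique_existence[of Q X]] unfolding Proj_def by blast+

lemma Proj_empty [simp]: "Proj {} X = 0"
  using Proj_in_span[of "{}" X] by simp

text \<open>Both residuals are orthogonal to \<open>Proj Q X\<close>, so \<open>X\<close> and
  \<open>Proj Q' X\<close> have the same inner product with it, namely its squared norm.\<close>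

lemma Proj_pythagoras:
  assumes "Q \<subseteq> Q'"
  shows "(norm (Proj Q' X - Proj Q X))\<^sup>2 = (norm (Proj Q' X))\<^sup>2 - (norm (Proj Q X))\<^sup>2"
proof -
  have "Proj Q X \<in> span (rank_one ` Q')"
    using Proj_in_span span_mono[OF image_mono[OF assms]] by blast
  then have "(X - Proj Q' X) \<bullet> Proj Q X = 0" "(X - Proj Q X) \<bullet> Proj Q X = 0"
    by (simp_all add: Proj_orthogonal Proj_in_span)
  then show ?thesis
    by (simp add: power2_norm_eq_inner inner_diff_left inner_diff_right inner_commute)
qed

lemma norm_Proj_le: "norm (Proj Q X) \<le> norm X"
proof -
  have "(norm X)\<^sup>2 = (norm (X - Proj Q X))\<^sup>2 + (norm (Proj Q X))\<^sup>2"
    using Proj_orthogonal[OF Proj_in_span, of X Q]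
    by (simp add: power2_norm_eq_inner inner_diff_left inner_diff_right inner_commute)
  then show ?thesis
    by (simp add: power2_le_imp_le)
qed

lemma P_norm_residual_le_proj_value:
  assumes "unit_domain P" "greedy_ordering P A p"
  shows "P_norm P (A - Proj (p ` {1..j}) A) \<le> proj_value A p (Suc j)"
proof -
  define u where "u = rank_one (p (Suc j))"
  let ?Q = "p ` {1..j}" and ?Q' = "p ` {1..Suc j}"
  have am: "is_arg_max (abs_form (A - Proj ?Q A)) (\<lambda>q. q \<in> P) (p (Suc j))"
    using assms(2) by (simp add: greedy_ordering_def)
  then have u: "norm u = 1"
    using assms(1) by (auto simp: u_def is_arg_max_def intro: norm_rank_one_unit_domain)
  have "(A - Proj ?Q' A) \<bullet> u = 0"
    unfolding u_def by (intro Proj_orthogonal span_base imageI) simp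
  then have "(A - Proj ?Q A) \<bullet> u = (Proj ?Q' A - Proj ?Q A) \<bullet> u"
    by (simp add: inner_diff_left)
  then have "P_norm P (A - Proj ?Q A) = \<bar>(Proj ?Q' A - Proj ?Q A) \<bullet> u\<bar>"
    using P_norm_eq_max[OF am] by (simp add: abs_form_eq_inner u_def)
  also have "\<dots> \<le> norm (Proj ?Q' A - Proj ?Q A)"
    using Cauchy_Schwarz_ineq2[of "Proj ?Q' A - Proj ?Q A" u] u by simp
  finally show ?thesis
    by (simp add: proj_value_def)
qed

text \<open>By Pythagoras along the nested sets of pairs the sum telescopes, starting from
  \<open>Proj {} A = 0\<close>.\<close>

lemma sum_proj_value_squares:
  "(\<Sum>j=1..k. (proj_value A p j)\<^sup>2) = (norm (Proj (p ` {1..k}) A))\<^sup>2"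
proof (induction k)
  case (Suc k)
  have "p ` {1..k} \<subseteq> p ` {1..Suc k}"
    by auto
  from Proj_pythagoras[OF this, of A] Suc show ?case
    by (simp add: proj_value_def)
qed simp

lemma L2_set_proj_value_le: "L2_set (proj_value A p) {1..k} \<le> norm A"
  unfolding L2_set_def sum_proj_value_squares by (simp add: norm_Proj_le)

lemma exists_le_L2_set_div_sqrt_card:
  assumes "finite S" "S \<noteq> {}" "\<And>i. i \<in> S \<Longrightarrow> 0 \<le> f i"
  shows "\<exists>i\<in>S. f i \<le> L2_set f S / sqrt (real (card S))"
proof -
  define i where "i = arg_min_on f S"
  have i: "i \<in> S" "\<And>j. j \<in> S \<Longrightarrow> f i \<le> f j"
    using assms arg_min_if_finite(1) arg_min_least unfolding i_def by metis+
  \<comment> \<open>Nonnegativity of \<open>f\<close> lets the minimality of \<open>f i\<close> pass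
    to squares.\<close>
  have "real (card S) * (f i)\<^sup>2 \<le> (\<Sum>j\<in>S. (f j)\<^sup>2)"
    using i assms by (intro sum_bounded_below power_mono) auto
  then have "sqrt (real (card S) * (f i)\<^sup>2) \<le> L2_set f S"
    unfolding L2_set_def by (rule real_sqrt_le_mono)
  moreover have "0 < card S"
    using assms by (simp add: card_gt_0_iff)
  ultimately have "f i \<le> L2_set f S / sqrt (real (card S))"
    using i(1) assms by (simp add: real_sqrt_mult field_simps)
  with i(1) show ?thesis ..
qed

text \<open>Coefficients are indexed by \<open>I\<close> rather than by the image, so
  \<open>f\<close> may repeat values, as happens when a pair is chosen again.\<close>

lemma span_image_finite_sum:
  fixes f :: "'i \<Rightarrow> 'a::real_vector"
  assumes "finite I" "x \<in> span (f ` I)"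
  shows "\<exists>c. x = (\<Sum>i\<in>I. c i *\<^sub>R f i)"
  using assms
proof (induction I arbitrary: x rule: finite_induct)
  case (insert i I)
  then obtain k where "x - k *\<^sub>R f i \<in> span (f ` I)"
    by (auto simp: span_insert)
  with insert.IH obtain c where "x - k *\<^sub>R f i = (\<Sum>j\<in>I. c j *\<^sub>R f j)"
    by blast
  then have "x = k *\<^sub>R f i + (\<Sum>j\<in>I. c j *\<^sub>R f j)"
    by (simp add: algebra_simps)
  also have "\<dots> = (\<Sum>j\<in>insert i I. (c(i := k)) j *\<^sub>R f j)"
    using insert.hyps by (auto intro: sum.cong)
  finally show ?case
    by (rule exI[of _ "c(i := k)"])
qed simp

theorem theorem17:
  fixes A :: "real^'n^'m"
    and P :: "((real^'m) \<times> (real^'n)) set"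
    and p :: "nat \<Rightarrow> (real^'m) \<times> (real^'n)"
    and r :: nat
  assumes "unit_domain P"
    and "greedy_ordering P A p"
  shows "\<exists>Ahat :: real^'n^'m.
           (\<exists>(c :: nat \<Rightarrow> real) (q :: nat \<Rightarrow> (real^'m) \<times> (real^'n)).
              (\<forall>i<r. q i \<in> P) \<and> Ahat = (\<Sum>i<r. c i *\<^sub>R rank_one (q i))) \<and>
           P_norm P (A - Ahat) \<le> L2_set (proj_value A p) {1..r + 1} / sqrt (real (r + 1)) \<and>
           L2_set (proj_value A p) {1..r + 1} / sqrt (real (r + 1)) \<le> norm A / sqrt (real (r + 1))"
proof -
  obtain k where k: "k \<in> {1..r + 1}"
    "proj_value A p k \<le> L2_set (proj_value A p) {1..r + 1} / sqrt (real (r + 1))"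
    using exists_le_L2_set_div_sqrt_card[of "{1..r + 1}" "proj_value A p"]
    by (auto simp: proj_value_def)
  \<comment> \<open>Projection values are counted from 1: the value at \<open>Suc j\<close> bounds
    the residual after only \<open>j\<close> steps, hence at most \<open>r\<close> pairs.\<close>
  then obtain j where j: "k = Suc j" "j \<le> r"
    by (cases k) auto
  define Ahat where "Ahat = Proj (p ` {1..j}) A"
  \<comment> \<open>The shift skips \<open>p 0\<close>, which may lie outside \<open>P\<close>. If
    \<open>j < r\<close>, further greedy pairs fill up the list to \<open>r\<close> terms, which
    only enlarges the span.\<close>
  define q where "q i = p (Suc i)" for i
  have "p ` {1..j} \<subseteq> q ` {..<r}"
    using j(2) by (force simp: q_def image_iff Suc_le_eq gr0_conv_Suc)
  then have "Ahat \<in> span (rank_one ` q ` {..<r})"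
    using Proj_in_span span_mono[OF image_mono] unfolding Ahat_def by blast
  then have "\<exists>c. Ahat = (\<Sum>i<r. c i *\<^sub>R rank_one (q i))"
    using span_image_finite_sum[of "{..<r}" Ahat "rank_one \<circ> q"] by (simp add: image_comp)
  moreover have "\<forall>i<r. q i \<in> P"
    using assms(2) by (simp add: q_def greedy_ordering_def is_arg_max_def)
  moreover have "P_norm P (A - Ahat) \<le> L2_set (proj_value A p) {1..r + 1} / sqrt (real (r + 1))"
    using order_trans[OF P_norm_residual_le_proj_value[OF assms, of j] k(2)[unfolded j(1)]]
    by (simp only: Ahat_def)
  moreover have "L2_set (proj_value A p) {1..r + 1} / sqrt (real (r + 1)) \<le> norm A / sqrt (real (r + 1))"
    by (intro divide_right_mono L2_set_proj_value_le) simp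
  ultimately show ?thesis
    by blast
qed

end
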